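(* Let $f$ and $g$ be functions whose generalized integrals $\mathrm{Z}\!\!\int_a^\infty f(x)\,dx$ and $\mathrm{Z}\!\!\int_a^\infty g(x)\,dx$ exist, and let $\alpha,\beta$ be constants. Then the generalized integral of $\alpha f+\beta g$ over $[a,\infty)$ exists and $$\alpha\,\mathrm{Z}\!\!\int_a^\infty f(x)\,dx+\beta\,\mathrm{Z}\!\!\int_a^\infty g(x)\,dx=\mathrm{Z}\!\!\int_a^\infty\left[\alpha f(x)+\beta g(x)\right]dx .$$
   Context: A termination function is a function $z:\mathbb{R}\to\mathbb{R}$ for which there is a finite constant $c>0$ such that $z(x)=1$ for $x\le 0$, $z(x)=0$ for $x\ge c$, $z'(x)\le 0$, and $\int_{-\infty}^{\infty} z'(x)\,dx=\int_0^c z'(x)\,dx=-1$. So $z$ is nonincreasing from $1$ to $0$. Jumps of $z$ are allowed, with $z'$ understood in the generalized sense (a jump contributes a Dirac delta, and integrals $\int_0^c\cdots z'(x)\,dx$ include point masses at the endpoints). The function $z$ does not depend on the limit variable $b$ below. The generalized integral of $f$ over $[a,\infty)$ with respect to $z$ is $$\lim_{b\to\infty}\left\{\int_a^b f(x)\,dx+\int_b^{b+c} f(x)\,z(x-b)\,dx\right\}.$$ It is said to exist with respect to $z$ when the (conventional, e.g. Riemann) integrals and the limit exist. The generalized integral $\mathrm{Z}\!\!\int_a^\infty f(x)\,dx$ is said to exist if the limit exists for some termination function $z$ and has the same value for all termination functions for which it exists; that common value is the value of the integral. The termination functions used for $f$ and for $g$ may be different. *)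

theory Defs
  imports "HOL-Analysis.Analysis"
begin

text \<open>
  A termination function may jump, so its derivative \<open>z'\<close> is taken to be the Lebesgue--Stieltjes
  measure \<open>dz\<close>.  As \<open>z\<close> is nonincreasing, this is a negative measure and we work with \<open>-dz\<close>.
  Passing to right limits is what \<^const>\<open>interval_measure\<close> requires; it does not alter the mass
  \<open>z(x-) - z(x+)\<close> put on the point \<open>x\<close>.
\<close>

definition neg_stieltjes_deriv :: "(real \<Rightarrow> real) \<Rightarrow> real measure" where
  "neg_stieltjes_deriv z = interval_measure (\<lambda>x. - Lim (at_right x) z)"

text \<open>
  The condition \<open>z' \<le> 0\<close> is antitonicity, and the last two conditions are
  \<open>\<integral> z' = \<integral>\<^sub>0\<^sup>c z' = -1\<close>, where the integral over \<open>[0, c]\<close> includes point masses at its endpoints.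
  They follow from the others, see \<open>termination_function_iff\<close>.
\<close>

definition termination_function :: "real \<Rightarrow> (real \<Rightarrow> real) \<Rightarrow> bool" where
  "termination_function c z \<longleftrightarrow>
     c > 0 \<and> (\<forall>x\<le>0. z x = 1) \<and> (\<forall>x\<ge>c. z x = 0) \<and> antimono z \<and>
     emeasure (neg_stieltjes_deriv z) UNIV = 1 \<and>
     emeasure (neg_stieltjes_deriv z) {0..c} = 1"

text \<open>
  The integrals over compact intervals are gauge integrals, which extend both the Riemann and the
  Lebesgue integral.  The choice of \<open>c\<close> among the constants admissible for \<open>z\<close> is immaterial.
\<close>

definition has_gen_integral_wrt ::
    "(real \<Rightarrow> 'a::real_normed_vector) \<Rightarrow> real \<Rightarrow> real \<Rightarrow> (real \<Rightarrow> real) \<Rightarrow> 'a \<Rightarrow> bool" where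
  "has_gen_integral_wrt f a c z L \<longleftrightarrow>
     (\<forall>b\<ge>a. f integrable_on {a..b} \<and> (\<lambda>x. z (x - b) *\<^sub>R f x) integrable_on {b..b + c}) \<and>
     ((\<lambda>b. integral {a..b} f + integral {b..b + c} (\<lambda>x. z (x - b) *\<^sub>R f x)) \<longlongrightarrow> L) at_top"

definition has_gen_integral :: "(real \<Rightarrow> 'a::real_normed_vector) \<Rightarrow> real \<Rightarrow> 'a \<Rightarrow> bool" where
  "has_gen_integral f a L \<longleftrightarrow>
     (\<exists>c z. termination_function c z \<and> has_gen_integral_wrt f a c z L) \<and>
     (\<forall>c z L'. termination_function c z \<and> has_gen_integral_wrt f a c z L' \<longrightarrow> L' = L)"

definition gen_integrable :: "(real \<Rightarrow> 'a::real_normed_vector) \<Rightarrow> real \<Rightarrow> bool" where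
  "gen_integrable f a \<longleftrightarrow> (\<exists>L. has_gen_integral f a L)"

definition gen_integral :: "(real \<Rightarrow> 'a::real_normed_vector) \<Rightarrow> real \<Rightarrow> 'a" where
  "gen_integral f a = (THE L. has_gen_integral f a L)"

lemma has_gen_integral_unique:
  "has_gen_integral f a L \<Longrightarrow> has_gen_integral f a L' \<Longrightarrow> L = L'"
  unfolding has_gen_integral_def by blast

lemma gen_integral_eqI: "has_gen_integral f a L \<Longrightarrow> gen_integral f a = L"
  unfolding gen_integral_def by (blast intro: has_gen_integral_unique)

lemma antimono_right_limit:
  fixes z :: "real \<Rightarrow> real"
  assumes z: "antimono z" and bd: "\<And>y. z y \<le> 1"
  shows "(z \<longlongrightarrow> Lim (at_right x) z) (at_right x)"
    and "y > x \<Longrightarrow> z y \<le> Lim (at_right x) z"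
    and "Lim (at_right x) z \<le> z x"
proof -
  define l where "l = (SUP y\<in>{x<..}. z y)"
  have bdd: "bdd_above (z ` {x<..})" using bd by (auto intro!: bdd_aboveI[of _ 1])
  have le: "z y \<le> l" if "y > x" for y
    unfolding l_def using that bdd by (intro cSUP_upper) auto
  have "(z \<longlongrightarrow> l) (at_right x)"
  proof (rule order_tendstoI)
    fix u assume "u < l"
    then obtain w where w: "w > x" "u < z w"
      unfolding l_def using bdd by (subst (asm) less_cSUP_iff) auto
    have "u < z y" if "y < w" for y
      using w(2) antimonoD[OF z, of y w] that by simp
    then show "\<forall>\<^sub>F y in at_right x. u < z y"
      using w(1) by (auto simp: eventually_at_right_field)
  next
    fix u assume "l < u"
    have "\<forall>\<^sub>F y in at_right x. y > x" by (simp add: eventually_at_right_less)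
    then show "\<forall>\<^sub>F y in at_right x. z y < u"
      by eventually_elim (meson le \<open>l < u\<close> le_less_trans)
  qed
  moreover from this have "Lim (at_right x) z = l" by (intro tendsto_Lim) auto
  moreover have "l \<le> z x"
    unfolding l_def
    by (rule cSUP_least) (use antimonoD[OF z, of x] in auto)
  ultimately show "(z \<longlongrightarrow> Lim (at_right x) z) (at_right x)"
    and "y > x \<Longrightarrow> z y \<le> Lim (at_right x) z" and "Lim (at_right x) z \<le> z x"
    using le by auto
qed

lemma termination_function_iff:
  "termination_function c z \<longleftrightarrow>
     c > 0 \<and> (\<forall>x\<le>0. z x = 1) \<and> (\<forall>x\<ge>c. z x = 0) \<and> antimono z"
proof
  assume "c > 0 \<and> (\<forall>x\<le>0. z x = 1) \<and> (\<forall>x\<ge>c. z x = 0) \<and> antimono z"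
  then have c: "c > 0" and z1: "\<And>x. x \<le> 0 \<Longrightarrow> z x = 1" and z0: "\<And>x. x \<ge> c \<Longrightarrow> z x = 0"
    and z: "antimono z" by auto
  have bd: "z y \<le> 1" for y
    using antimonoD[OF z, of "min y 0" y] z1[of "min y 0"] by auto
  define F where "F = (\<lambda>x. - Lim (at_right x) z)"
  note lim = antimono_right_limit[OF z bd]
  have F0: "F x = 0" if "x \<ge> c" for x
    using lim(2)[of x "x + 1"] lim(3)[of x] z0[of x] z0[of "x + 1"] that
    by (auto simp: F_def)
  have F1: "F x = -1" if "x < 0" for x
    using lim(2)[of x "x / 2"] lim(3)[of x] z1[of x] z1[of "x / 2"] that
    by (auto simp: F_def)
  have monoF: "F x \<le> F y" if "x \<le> y" for x y
    using that lim(2)[of x y] lim(3)[of y] by (cases "x = y") (auto simp: F_def)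
  have contF: "continuous (at_right x) F" for x
  proof -
    have "(F \<longlongrightarrow> F x) (at_right x)"
    proof (rule order_tendstoI)
      fix u assume "u < F x"
      have "\<forall>\<^sub>F y in at_right x. y > x" by (simp add: eventually_at_right_less)
      then show "\<forall>\<^sub>F y in at_right x. u < F y"
        by eventually_elim (meson monoF \<open>u < F x\<close> less_imp_le less_le_trans)
    next
      fix u assume "F x < u"
      then have "\<forall>\<^sub>F y in at_right x. - u < z y"
        using order_tendstoD(1)[OF lim(1), of "- u" x] by (simp add: F_def)
      then obtain w where w: "w > x" "\<And>y. x < y \<Longrightarrow> y < w \<Longrightarrow> - u < z y"
        by (auto simp: eventually_at_right_field)
      have "F y < u" if "x < y" "y < w" for y
        using lim(2)[of y "(y + w) / 2"] w(2)[of "(y + w) / 2"] that by (auto simp: F_def)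
      then show "\<forall>\<^sub>F y in at_right x. F y < u"
        using w(1) by (auto simp: eventually_at_right_field)
    qed
    then show ?thesis by (simp add: continuous_within)
  qed
  define M where "M = interval_measure F"
  have setsM [simp]: "sets M = sets borel" by (simp add: M_def)
  have Ioc: "emeasure M {u<..v} = ennreal (F v - F u)" if "u \<le> v" for u v
    unfolding M_def using that monoF contF by (intro emeasure_interval_measure_Ioc) auto
  have U: "emeasure M UNIV = 1"
  proof -
    define A where "A n = {- 1 - real n<..c + real n}" for n
    have "incseq A" by (auto simp: A_def incseq_def)
    moreover have "(\<Union>n. A n) = UNIV"
    proof -
      have "x \<in> (\<Union>n. A n)" for x
      proof -
        obtain n where "\<bar>x\<bar> < real n" using reals_Archimedean2 by blast
        then show ?thesis using c by (auto simp: A_def intro!: exI[of _ n])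
      qed
      then show ?thesis by blast
    qed
    moreover have "emeasure M (A n) = 1" for n
      unfolding A_def using c by (subst Ioc) (auto simp: F0 F1)
    ultimately show ?thesis
      using SUP_emeasure_incseq[of A M] by (force simp: A_def)
  qed
  have "emeasure M {0..c} = 1"
  proof -
    define A where "A n = {- inverse (real (Suc n))<..c}" for n
    have "decseq A"
    proof (rule decseq_SucI)
      fix n
      have "inverse (real (Suc (Suc n))) \<le> inverse (real (Suc n))"
        by (intro le_imp_inverse_le) auto
      then have "- inverse (real (Suc n)) \<le> - inverse (real (Suc (Suc n)))" by linarith
      then show "A (Suc n) \<subseteq> A n"
        unfolding A_def by (meson greaterThanAtMost_iff le_less_trans subsetI)
    qed
    moreover have "(\<Inter>n. A n) = {0..c}"
    proof -
      have "x \<ge> 0" if "\<And>n. - inverse (real (Suc n)) < x" for x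
      proof (rule ccontr)
        assume "\<not> x \<ge> 0"
        then obtain n where "inverse (real (Suc n)) < - x"
          using reals_Archimedean[of "- x"] by auto
        then show False using that[of n] by simp
      qed
      moreover have "- inverse (real (Suc n)) < x" if "x \<ge> 0" for n x
        using that by (meson inverse_positive_iff_positive less_le_trans neg_less_0_iff_less
            of_nat_0_less_iff zero_less_Suc)
      ultimately show ?thesis by (auto simp: A_def)
    qed
    moreover have one: "emeasure M (A n) = 1" for n
    proof -
      have neg: "- inverse (real (Suc n)) < 0" by simp
      show ?thesis unfolding A_def using c neg Ioc[of "- inverse (real (Suc n))" c] F1[OF neg] F0[of c]
        by (metis diff_0 ennreal_1 less_imp_le less_trans minus_minus order_refl)
    qed
    moreover have "range A \<subseteq> sets M" by (auto simp: A_def)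
    ultimately have "(INF n. emeasure M (A n)) = emeasure M {0..c}"
      using INF_emeasure_decseq[of A M] by (metis ennreal_one_neq_top infinity_ennreal_def)
    then show ?thesis unfolding one by simp
  qed
  with U show "termination_function c z"
    unfolding termination_function_def neg_stieltjes_deriv_def M_def F_def
    using c z z1 z0 by auto
qed (unfold termination_function_def, blast)

end

theory Submission
  imports Defs "HOL-Probability.Convolution"
begin

text \<open>
  Write \<open>F x\<close> for the integral of \<open>f\<close> over \<open>[a, x]\<close>, and let \<open>M\<close> be the measure \<open>-dz\<close>, a
  probability measure on \<open>[0, c]\<close>.  Integration by parts turns the terminated integral into an
  average of \<open>F\<close>,
  \[ \int_a^b f(x)\,dx + \int_b^{b+c} f(x)\,z(x-b)\,dx = \int F(b+t)\,dM(t) \]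
  (\<open>has_integral_tail\<close>), so that the generalized integral with respect to \<open>z\<close> is the limit of the
  averages on the right (\<open>has_gen_integral_wrt_iff\<close>).  Since \<open>f\<close> is merely gauge integrable, this
  formula is not an instance of Fubini's theorem; it rests on the second mean value theorem and on
  the continuity of \<open>F\<close> (\<open>has_integral_tail_real\<close>).

  Convergence of the averages against \<open>M\<close> implies convergence of the averages against the
  convolution of \<open>M\<close> with any other probability measure \<open>N\<close> on a compact interval of nonnegative
  numbers, with the same limit: the new average at \<open>b\<close> is an \<open>N\<close>-average of old ones at points
  \<open>b + t \<ge> b\<close> (\<open>tendsto_convolution_right\<close>).  Convolution is commutative, so \<open>M\<close> and \<open>N\<close> play
  symmetric roles (\<open>tendsto_convolution_left\<close>).  This has two consequences.
  If the limits for two termination functions of the same \<open>f\<close> both exist, they coincide, as both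
  equal the limit for the convolution (\<open>has_gen_integral_wrt_unique\<close>); hence the uniqueness clause in the definition of the
  generalized integral holds automatically.  And if \<open>f\<close> and \<open>g\<close> have generalized integrals with
  respect to \<open>z\<close> and \<open>w\<close>, then both have them with respect to one common termination function,
  obtained from the convolution of \<open>-dz\<close> and \<open>-dw\<close>, where linearity is that of the ordinary
  integral and of limits (\<open>has_gen_integral_linear\<close>).
\<close>

section \<open>Terminated integrals as averages of the indefinite integral\<close>

text \<open>
  \<open>M\<close> is a Borel probability measure concentrated on \<open>[0, c]\<close>.
\<close>

definition distr_on :: "real measure \<Rightarrow> real \<Rightarrow> bool" where
  "distr_on M c \<longleftrightarrow> prob_space M \<and> sets M = sets borel \<and> (AE t in M. t \<in> {0..c})"

text \<open>
  \<open>z\<close> is the tail function \<open>x \<mapsto> M(x, \<infinity>)\<close> up to a countable set.  The exceptional set leaves the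
  values of \<open>z\<close> at its jumps unspecified; being Lebesgue null, it does not affect integrals against
  \<open>z\<close>.
\<close>

definition tail_of :: "real measure \<Rightarrow> (real \<Rightarrow> real) \<Rightarrow> bool" where
  "tail_of M z \<longleftrightarrow> countable {x. z x \<noteq> measure M {x<..}}"

lemma continuous_indefinite_integral:
  fixes f :: "real \<Rightarrow> 'a::euclidean_space"
  assumes f: "\<And>b. b \<ge> a \<Longrightarrow> f integrable_on {a..b}"
  shows "continuous_on UNIV (\<lambda>x. integral {a..x} f)"
proof -
  have "continuous_on ({..a} \<union> {a..}) (\<lambda>x. integral {a..x} f)"
  proof (intro continuous_on_closed_Un)
    have "continuous_on {..a} (\<lambda>x. 0::'a)" by simp
    moreover have "integral {a..x} f = 0" if "x \<le> a" for x
      using that by (cases "x = a") auto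
    ultimately show "continuous_on {..a} (\<lambda>x. integral {a..x} f)"
      by (subst continuous_on_cong[OF refl]) auto
    show "continuous_on {a..} (\<lambda>x. integral {a..x} f)"
      unfolding continuous_on_eq_continuous_within
    proof
      fix x assume "x \<in> {a..}"
      then have "continuous_on {a..x + 1} (\<lambda>x. integral {a..x} f)"
        by (intro indefinite_integral_continuous_1 f) auto
      then have "continuous (at x within {a..x + 1}) (\<lambda>x. integral {a..x} f)"
        using \<open>x \<in> {a..}\<close> by (auto simp: continuous_on_eq_continuous_within)
      moreover have "at x within {a..} = at x within {a..x + 1}"
        by (rule at_within_nhd[of _ "{x - 1<..<x + 1}"]) auto
      ultimately show "continuous (at x within {a..}) (\<lambda>x. integral {a..x} f)" by simp
    qed
  qed auto
  moreover have "{..a} \<union> {a..} = UNIV" by auto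
  ultimately show ?thesis by simp
qed

lemma integrable_translate:
  fixes F :: "real \<Rightarrow> 'a::euclidean_space"
  assumes M: "distr_on M c" and F: "continuous_on UNIV F"
  shows "integrable M (\<lambda>t. F (b + t))"
proof -
  interpret prob_space M using M by (simp add: distr_on_def)
  have [measurable_cong]: "sets M = sets borel" using M by (simp add: distr_on_def)
  have [measurable]: "F \<in> borel_measurable borel"
    using F by (rule borel_measurable_continuous_onI)
  have "compact ((\<lambda>t. F (b + t)) ` {0..c})"
    by (intro compact_continuous_image continuous_on_compose2[OF F] continuous_intros) auto
  then obtain B where B: "\<And>t. t \<in> {0..c} \<Longrightarrow> norm (F (b + t)) \<le> B"
    by (fastforce dest!: compact_imp_bounded simp: bounded_iff)
  show ?thesis
  proof (rule integrable_const_bound)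
    show "AE t in M. norm (F (b + t)) \<le> B"
      using M B unfolding distr_on_def by (auto elim: eventually_mono)
  qed simp
qed

text \<open>
  The formula for integration by parts when \<open>f\<close> is real, for the indefinite integral \<open>\<Phi>\<close> of
  \<open>f\<close> that vanishes at \<open>b\<close>.
  Both sides are the values at \<open>v = b + c\<close> of functions \<open>J\<close> and \<open>K\<close> of \<open>v\<close> that vanish at
  \<open>v = b\<close>.  On a short interval \<open>[u, v]\<close> each of their increments differs from
  \<open>Z (v - b) * (\<Phi> v - \<Phi> u)\<close>, where \<open>Z x = M(x, \<infinity>)\<close>, by at most the mass
  \<open>Z (u - b) - Z (v - b)\<close> times the oscillation of \<open>\<Phi>\<close> on the interval.  These errors add up, so
  \<open>J (b + c) - K (b + c)\<close> is at most twice the largest oscillation, which is as small as desired.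
\<close>

lemma has_integral_tail_real:
  fixes f :: "real \<Rightarrow> real"
  assumes M: "distr_on M c" and c: "c > 0" and f: "\<And>x. x \<ge> b \<Longrightarrow> f integrable_on {b..x}"
  shows "((\<lambda>x. measure M {x - b<..} * f x) has_integral
           (LINT t|M. integral {b..b + t} f)) {b..b + c}"
proof -
  interpret prob_space M using M by (simp add: distr_on_def)
  have sets [measurable_cong]: "sets M = sets borel" using M by (simp add: distr_on_def)
  have AE: "AE t in M. t \<in> {0..c}" using M by (simp add: distr_on_def)
  define \<Phi> where "\<Phi> x = integral {b..x} f" for x
  define Z where "Z x = measure M {x<..}" for x
  have \<Phi>: "continuous_on UNIV \<Phi>"
    unfolding \<Phi>_def using f by (rule continuous_indefinite_integral)
  have [measurable]: "\<Phi> \<in> borel_measurable borel"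
    using \<Phi> by (rule borel_measurable_continuous_onI)
  have \<Phi>0: "\<Phi> x = 0" if "x \<le> b" for x
    using that by (cases "x = b") (auto simp: \<Phi>_def)
  have fI: "f integrable_on {u..v}" if "b \<le> u" for u v
    by (rule integrable_on_subinterval[OF f[of "max b v"]]) (use that in auto)
  have \<Phi>diff: "integral {u..v} f = \<Phi> v - \<Phi> u" if "b \<le> u" "u \<le> v" for u v
    using Henstock_Kurzweil_Integration.integral_combine[of b u v f] that fI[of b v]
    by (auto simp: \<Phi>_def)
  have Zanti: "Z y \<le> Z x" if "x \<le> y" for x y
    unfolding Z_def using that by (intro finite_measure_mono) (auto simp: sets)
  have Zdiff: "measure M {x<..y} = Z x - Z y" if "x \<le> y" for x y
  proof -
    have "{x<..y} = {x<..} - {y<..}" by auto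
    moreover have "measure M ({x<..} - {y<..}) = Z x - Z y"
      unfolding Z_def by (rule finite_measure_Diff) (use that in \<open>auto simp: sets\<close>)
    ultimately show ?thesis by simp
  qed
  have smvt: "\<exists>\<xi>\<in>{u..v}. ((\<lambda>x. Z (x - b) * f x) has_integral
      (Z (u - b) * (\<Phi> \<xi> - \<Phi> u) + Z (v - b) * (\<Phi> v - \<Phi> \<xi>))) {u..v}"
    if uv: "b \<le> u" "u \<le> v" for u v
  proof -
    obtain \<xi> where \<xi>: "\<xi> \<in> {u..v}" "((\<lambda>x. - Z (x - b) * f x) has_integral
        (- Z (u - b) * integral {u..\<xi>} f + - Z (v - b) * integral {\<xi>..v} f)) {u..v}"
      using second_mean_value_theorem_full[of f u v "\<lambda>x. - Z (x - b)"] fI[of u v] uv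
      by (auto simp: Zanti)
    from has_integral_neg[OF \<xi>(2)] show ?thesis
      using \<xi>(1) uv by (intro bexI[of _ \<xi>]) (auto simp: \<Phi>diff add.commute)
  qed
  define J where "J v = integral {b..v} (\<lambda>x. Z (x - b) * f x)" for v
  \<comment> \<open>Truncating at \<open>v\<close> makes \<open>K\<close> run from \<open>0\<close> at \<open>v = b\<close> to the full average at \<open>v = b + c\<close>.\<close>
  define K where "K v = (LINT t|M. \<Phi> (min (b + t) v))" for v
  have int: "integrable M (\<lambda>t. \<Phi> (min (b + t) v))" for v
    by (rule integrable_translate[OF M, of "\<lambda>x. \<Phi> (min x v)"])
      (intro continuous_on_compose2[OF \<Phi>] continuous_intros, auto)
  have Jdiff: "J v - J u = integral {u..v} (\<lambda>x. Z (x - b) * f x)" if "b \<le> u" "u \<le> v" for u v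
    using Henstock_Kurzweil_Integration.integral_combine[of b u v "\<lambda>x. Z (x - b) * f x"]
      that smvt[of b v]
    by (force simp: J_def has_integral_integrable)
  have main: "\<bar>(J (b + c) - K (b + c)) - (J b - K b)\<bar> \<le> 2 * \<epsilon> * (Z 0 - Z c)" if \<epsilon>: "\<epsilon> > 0" for \<epsilon>
  proof -
    define P where "P u v \<longleftrightarrow> (b \<le> u \<and> u \<le> v \<longrightarrow>
      \<bar>(J v - K v) - (J u - K u)\<bar> \<le> 2 * \<epsilon> * (Z (u - b) - Z (v - b)))" for u v
    \<comment> \<open>The bound is additive in the interval, so by bisection it only has to be shown locally.\<close>
    have "P b (b + c)"
    proof (rule Bolzano)
      show "b \<le> b + c" using c by simp
    next
      fix u v w assume "P u v" "P v w" "u \<le> v" "v \<le> w"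
      then show "P u w" by (auto simp: P_def algebra_simps)
    next
      fix x assume "b \<le> x" "x \<le> b + c"
      have "isCont \<Phi> x" using \<Phi> by (simp add: continuous_on_eq_continuous_at)
      then obtain d where d: "d > 0" "\<And>y. \<bar>y - x\<bar> < d \<Longrightarrow> \<bar>\<Phi> y - \<Phi> x\<bar> < \<epsilon> / 2"
        using \<epsilon> unfolding continuous_at_eps_delta dist_real_def
        by (meson half_gt_zero)
      have "P u v" if "u \<le> x" "x \<le> v" "v - u < d" for u v
        unfolding P_def
      proof (intro impI, elim conjE)
        assume u: "b \<le> u" and uv: "u \<le> v"
        have osc: "\<bar>\<Phi> y - \<Phi> u\<bar> \<le> \<epsilon>" if "y \<in> {u..v}" for y
        proof -
          have "\<bar>\<Phi> y - \<Phi> x\<bar> < \<epsilon> / 2" "\<bar>\<Phi> u - \<Phi> x\<bar> < \<epsilon> / 2"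
            by (rule d(2), use that \<open>u \<le> x\<close> \<open>x \<le> v\<close> \<open>v - u < d\<close> in \<open>simp add: abs_le_iff abs_less_iff\<close>)+
          then show ?thesis by linarith
        qed
        have Zuv: "0 \<le> Z (u - b) - Z (v - b)" using Zanti[of "u - b" "v - b"] uv by simp
        obtain \<xi> where \<xi>: "\<xi> \<in> {u..v}"
          "J v - J u = Z (u - b) * (\<Phi> \<xi> - \<Phi> u) + Z (v - b) * (\<Phi> v - \<Phi> \<xi>)"
          using smvt[OF u uv] Jdiff[OF u uv] by (auto dest: integral_unique)
        have J: "\<bar>J v - J u - Z (v - b) * (\<Phi> v - \<Phi> u)\<bar> \<le> \<epsilon> * (Z (u - b) - Z (v - b))"
        proof -
          have "J v - J u - Z (v - b) * (\<Phi> v - \<Phi> u) = (\<Phi> \<xi> - \<Phi> u) * (Z (u - b) - Z (v - b))"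
            unfolding \<xi>(2) by (simp add: algebra_simps)
          then show ?thesis
            using osc[OF \<xi>(1)] Zuv by (simp add: abs_mult mult_right_mono)
        qed
        \<comment> \<open>The part of the increment of \<open>K\<close> that comes from \<open>b + t\<close> inside \<open>(u, v]\<close>.\<close>
        define h where "h t = indicat_real {u - b<..v - b} t * (\<Phi> (b + t) - \<Phi> u)" for t
        have hle: "\<bar>h t\<bar> \<le> \<epsilon> * indicat_real {u - b<..v - b} t" for t
          using osc[of "b + t"] by (auto simp: h_def indicator_def)
        have hint: "integrable M h"
        proof (rule integrable_const_bound)
          show "AE t in M. norm (h t) \<le> \<epsilon>"
            using osc[of "b + _"] \<epsilon> by (auto simp: h_def indicator_def)
          show "h \<in> borel_measurable M" unfolding h_def by measurable
        qed
        have iint: "integrable M (\<lambda>t. indicat_real S t * k)" if "S \<in> sets borel" for S k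
          using that by (intro integrable_mult_left integrable_real_indicator)
            (auto simp: sets emeasure_eq_measure)
        have "K v - K u = (LINT t|M. \<Phi> (min (b + t) v) - \<Phi> (min (b + t) u))"
          unfolding K_def by (simp add: int)
        also have "\<dots> = (LINT t|M. indicat_real {v - b<..} t * (\<Phi> v - \<Phi> u) + h t)"
          using uv by (intro Bochner_Integration.integral_cong refl)
            (auto simp: h_def indicator_def min_def)
        also have "\<dots> = Z (v - b) * (\<Phi> v - \<Phi> u) + (LINT t|M. h t)"
          using sets_eq_imp_space_eq[OF sets] iint[of "{v - b<..}" 1]
          by (subst Bochner_Integration.integral_add) (auto simp: hint iint Z_def sets)
        finally have K: "K v - K u = Z (v - b) * (\<Phi> v - \<Phi> u) + (LINT t|M. h t)" .
        have "\<bar>LINT t|M. h t\<bar> \<le> (LINT t|M. \<bar>h t\<bar>)" by (rule integral_abs_bound)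
        also have "\<dots> \<le> (LINT t|M. indicat_real {u - b<..v - b} t * \<epsilon>)"
          using hle by (intro integral_mono integrable_abs hint iint) (auto simp: mult.commute)
        also have "\<dots> = \<epsilon> * (Z (u - b) - Z (v - b))"
          using sets_eq_imp_space_eq[OF sets] uv Zdiff[of "u - b" "v - b"] by simp
        finally show "\<bar>(J v - K v) - (J u - K u)\<bar> \<le> 2 * \<epsilon> * (Z (u - b) - Z (v - b))"
          using J K by (simp add: algebra_simps)
      qed
      then show "\<exists>d>0. \<forall>u v. u \<le> x \<and> x \<le> v \<and> v - u < d \<longrightarrow> P u v" using d(1) by blast
    qed
    then show ?thesis using c by (simp add: P_def)
  qed
  have "J b - K b = 0" by (simp add: J_def K_def \<Phi>0)
  have "Z 0 - Z c \<le> 1"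
    using prob_le_1[of "{0<..}"] measure_nonneg[of M "{c<..}"] unfolding Z_def by linarith
  have le: "\<bar>J (b + c) - K (b + c)\<bar> \<le> 2 * \<epsilon>" if "\<epsilon> > 0" for \<epsilon>
  proof -
    have "2 * \<epsilon> * (Z 0 - Z c) \<le> 2 * \<epsilon>"
      using mult_left_mono[of "Z 0 - Z c" 1 "2 * \<epsilon>"] \<open>Z 0 - Z c \<le> 1\<close> that by simp
    then show ?thesis using main[OF that] \<open>J b - K b = 0\<close> by simp
  qed
  have "\<bar>J (b + c) - K (b + c)\<bar> \<le> 0"
    by (rule field_le_epsilon) (use le[of "_ / 2"] in simp)
  then have "J (b + c) = K (b + c)" by simp
  also have "K (b + c) = (LINT t|M. \<Phi> (b + t))"
    unfolding K_def
  proof (rule integral_cong_AE)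
    show "AE t in M. \<Phi> (min (b + t) (b + c)) = \<Phi> (b + t)"
      using AE by eventually_elim (simp add: min_def)
  qed measurable
  finally have "J (b + c) = (LINT t|M. \<Phi> (b + t))" .
  moreover have "(\<lambda>x. Z (x - b) * f x) integrable_on {b..b + c}"
    using smvt[of b "b + c"] c by (auto simp: has_integral_integrable)
  ultimately show ?thesis
    unfolding J_def Z_def \<Phi>_def by (metis integrable_integral)
qed

lemma has_integral_tail:
  fixes f :: "real \<Rightarrow> 'a::euclidean_space"
  assumes M: "distr_on M c" and c: "c > 0" and z: "tail_of M z"
    and f: "\<And>x. x \<ge> a \<Longrightarrow> f integrable_on {a..x}" and b: "b \<ge> a"
  shows "((\<lambda>x. z (x - b) *\<^sub>R f x) has_integral
           (LINT t|M. integral {a..b + t} f) - integral {a..b} f) {b..b + c}"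
  unfolding has_integral_componentwise_iff[where f = "\<lambda>x. z (x - b) *\<^sub>R f x"]
proof
  fix i :: 'a assume i: "i \<in> Basis"
  interpret prob_space M using M by (simp add: distr_on_def)
  have sets [measurable_cong]: "sets M = sets borel" using M by (simp add: distr_on_def)
  have AE: "AE t in M. t \<in> {0..c}" using M by (simp add: distr_on_def)
  have fI: "f integrable_on {u..v}" if "a \<le> u" for u v
    by (rule integrable_on_subinterval[OF f[of "max a v"]]) (use that in auto)
  have fiI: "(\<lambda>x. f x \<bullet> i) integrable_on {u..v}" if "a \<le> u" for u v
    using integrable_component[OF fI[OF that]] .
  have F: "continuous_on UNIV (\<lambda>x. integral {a..x} f)"
    using f by (rule continuous_indefinite_integral)
  have G: "continuous_on UNIV (\<lambda>x. integral {b..x} (\<lambda>x. f x \<bullet> i))"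
    by (rule continuous_indefinite_integral) (use fiI b in auto)
  have [measurable]: "(\<lambda>x. integral {a..x} f) \<in> borel_measurable borel"
    "(\<lambda>x. integral {b..x} (\<lambda>x. f x \<bullet> i)) \<in> borel_measurable borel"
    using F G by (auto intro: borel_measurable_continuous_onI)
  have Fint: "integrable M (\<lambda>t. integral {a..b + t} f)"
    by (rule integrable_translate[OF M F])
  have "((LINT t|M. integral {a..b + t} f) - integral {a..b} f) \<bullet> i
      = (LINT t|M. (integral {a..b + t} f - integral {a..b} f) \<bullet> i)"
    using Fint by (simp add: prob_space)
  also have "\<dots> = (LINT t|M. integral {b..b + t} (\<lambda>x. f x \<bullet> i))"
  proof (rule integral_cong_AE)
    show "AE t in M. (integral {a..b + t} f - integral {a..b} f) \<bullet> i
        = integral {b..b + t} (\<lambda>x. f x \<bullet> i)"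
      using AE
    proof eventually_elim
      case (elim t)
      then have "integral {a..b} f + integral {b..b + t} f = integral {a..b + t} f"
        using b fI by (intro Henstock_Kurzweil_Integration.integral_combine) auto
      then have "integral {a..b + t} f - integral {a..b} f = integral {b..b + t} f"
        by (simp add: algebra_simps)
      then show ?case
        using integral_component_eq[OF fI[OF b]] by simp
    qed
  qed measurable
  finally have eq: "((LINT t|M. integral {a..b + t} f) - integral {a..b} f) \<bullet> i
      = (LINT t|M. integral {b..b + t} (\<lambda>x. f x \<bullet> i))" .
  have "{x. z (x - b) \<noteq> measure M {x - b<..}} = (+) b ` {x. z x \<noteq> measure M {x<..}}"
    by (auto simp: image_iff intro!: exI[of _ "_ - b"])
  then have "countable {x. z (x - b) \<noteq> measure M {x - b<..}}"
    using z by (simp add: tail_of_def)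
  then have neg: "negligible {x. z (x - b) \<noteq> measure M {x - b<..}}"
    by (simp add: negligible_iff_null_sets countable_imp_null_set_lborel null_sets_completionI)
  have "((\<lambda>x. measure M {x - b<..} * (f x \<bullet> i)) has_integral
      (LINT t|M. integral {b..b + t} (\<lambda>x. f x \<bullet> i))) {b..b + c}"
    using M c fiI[OF b] by (rule has_integral_tail_real)
  then show "((\<lambda>x. z (x - b) *\<^sub>R f x \<bullet> i) has_integral
      ((LINT t|M. integral {a..b + t} f) - integral {a..b} f) \<bullet> i) {b..b + c}"
    unfolding eq by (rule has_integral_spike[OF neg, rotated]) simp
qed

lemma has_gen_integral_wrt_iff:
  fixes f :: "real \<Rightarrow> 'a::euclidean_space"
  assumes "distr_on M c" "c > 0" "tail_of M z"
  shows "has_gen_integral_wrt f a c z L \<longleftrightarrow>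
    (\<forall>b\<ge>a. f integrable_on {a..b}) \<and>
    ((\<lambda>b. LINT t|M. integral {a..b + t} f) \<longlongrightarrow> L) at_top"
proof (cases "\<forall>b\<ge>a. f integrable_on {a..b}")
  case True
  note tail = has_integral_tail[OF assms, of a f]
  have "(\<lambda>x. z (x - b) *\<^sub>R f x) integrable_on {b..b + c}" if "b \<ge> a" for b
    using tail[OF _ that] True by (auto simp: has_integral_integrable)
  moreover have "\<forall>\<^sub>F b in at_top. integral {a..b} f + integral {b..b + c} (\<lambda>x. z (x - b) *\<^sub>R f x)
      = (LINT t|M. integral {a..b + t} f)"
    using eventually_ge_at_top[of a]
    by eventually_elim (use tail[THEN integral_unique] True in simp)
  ultimately show ?thesis
    unfolding has_gen_integral_wrt_def using True by (simp cong: tendsto_cong)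
qed (auto simp: has_gen_integral_wrt_def)

section \<open>Termination functions and probability measures\<close>

text \<open>
  The measure is \<open>-dz\<close>.  Its tail at \<open>x\<close> is the right limit of \<open>z\<close>, which differs from \<open>z x\<close> only
  at the countably many discontinuities of the monotone function \<open>z\<close>.
\<close>

lemma termination_function_distr:
  assumes "termination_function c z"
  shows "c > 0" and "\<exists>M. distr_on M c \<and> tail_of M z"
proof -
  show c: "c > 0" using assms by (simp add: termination_function_def)
  have z1: "\<And>x. x \<le> 0 \<Longrightarrow> z x = 1" and z0: "\<And>x. x \<ge> c \<Longrightarrow> z x = 0" and z: "antimono z"
    using assms by (auto simp: termination_function_def)
  define M where "M = neg_stieltjes_deriv z"
  have sets [measurable_cong]: "sets M = sets borel" by (simp add: M_def neg_stieltjes_deriv_def)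
  have space: "space M = UNIV" using sets_eq_imp_space_eq[OF sets] by simp
  have M1: "emeasure M UNIV = 1" "emeasure M {0..c} = 1"
    using assms by (auto simp: termination_function_def M_def)
  interpret prob_space M by standard (simp add: space M1)
  have AE: "AE t in M. t \<in> {0..c}"
    by (rule AE_prob_1) (simp add: measure_def M1)
  have bd: "z y \<le> 1" for y
    using antimonoD[OF z, of "min y 0" y] z1[of "min y 0"] by auto
  define F where "F = (\<lambda>x. - Lim (at_right x) z)"
  note lim = antimono_right_limit[OF z bd]
  have F0: "F x = 0" if "x \<ge> c" for x
    using lim(2)[of x "x + 1"] lim(3)[of x] z0[of x] z0[of "x + 1"] that
    by (auto simp: F_def)
  have monoF: "F x \<le> F y" if "x \<le> y" for x y
    using that lim(2)[of x y] lim(3)[of y] by (cases "x = y") (auto simp: F_def)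
  have contF: "continuous (at_right x) F" for x
  proof -
    have "(F \<longlongrightarrow> F x) (at_right x)"
    proof (rule order_tendstoI)
      fix u assume "u < F x"
      show "\<forall>\<^sub>F y in at_right x. u < F y"
        using eventually_at_right_less[of x]
      proof eventually_elim
        case (elim y)
        then show ?case using \<open>u < F x\<close> monoF[of x y] by linarith
      qed
    next
      fix u assume "F x < u"
      then have "\<forall>\<^sub>F y in at_right x. - u < z y"
        using order_tendstoD(1)[OF lim(1), of "- u" x] by (simp add: F_def)
      then obtain w where w: "w > x" "\<And>y. x < y \<Longrightarrow> y < w \<Longrightarrow> - u < z y"
        by (auto simp: eventually_at_right_field)
      have "F y < u" if "x < y" "y < w" for y
        using lim(2)[of y "(y + w) / 2"] w(2)[of "(y + w) / 2"] that by (auto simp: F_def)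
      then show "\<forall>\<^sub>F y in at_right x. F y < u"
        using w(1) by (auto simp: eventually_at_right_field)
    qed
    then show ?thesis by (simp add: continuous_within)
  qed
  have tail: "measure M {x<..} = Lim (at_right x) z" for x
  proof -
    have "AE t in M. (t \<in> {x<..}) = (t \<in> {x<..max x c})"
      using AE by eventually_elim auto
    then have "measure M {x<..} = measure M {x<..max x c}"
      by (rule measure_eq_AE) (auto simp: sets)
    also have "\<dots> = F (max x c) - F x"
      using emeasure_interval_measure_Ioc[of x "max x c" F] monoF contF monoF[of x "max x c"]
      by (simp add: M_def neg_stieltjes_deriv_def F_def[symmetric] measure_def)
    finally show ?thesis by (simp add: F0 F_def[symmetric]) (simp add: F_def)
  qed
  have "mono (\<lambda>x. - z x)" using z by (auto simp: antimono_def mono_def)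
  then have "countable {x. \<not> isCont (\<lambda>x. - z x) x}" by (rule mono_ctble_discont)
  moreover have "{x. z x \<noteq> measure M {x<..}} \<subseteq> {x. \<not> isCont (\<lambda>x. - z x) x}"
  proof safe
    fix x assume ne: "z x \<noteq> measure M {x<..}" and "isCont (\<lambda>x. - z x) x"
    from this(2) have "(z \<longlongrightarrow> z x) (at x)"
      using continuous_minus[of "at x" "\<lambda>x. - z x"] by (simp add: continuous_within)
    then have "(z \<longlongrightarrow> z x) (at_right x)" by (rule tendsto_within_subset) simp
    then have "Lim (at_right x) z = z x" by (intro tendsto_Lim) auto
    with ne tail show False by simp
  qed
  ultimately have "tail_of M z" unfolding tail_of_def by (rule countable_subset[rotated])
  moreover have "distr_on M c"
    unfolding distr_on_def using AE sets prob_space_axioms by blast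
  ultimately show "\<exists>M. distr_on M c \<and> tail_of M z" by blast
qed

text \<open>
  Conversely every Borel probability measure on \<open>[0, c]\<close> comes from a termination function.  The closed
  tail \<open>M[x, \<infinity>)\<close> is used because it equals \<open>1\<close> at \<open>x = 0\<close> even if \<open>0\<close> is an atom; as it may be
  positive at \<open>x = c\<close>, the constant has to be enlarged, here to \<open>c + 1\<close>.
\<close>

lemma distr_termination_function:
  assumes "distr_on M c" "c > 0"
  shows "termination_function (c + 1) (\<lambda>x. measure M {x..})"
    and "distr_on M (c + 1)" and "tail_of M (\<lambda>x. measure M {x..})"
proof -
  interpret prob_space M using assms by (simp add: distr_on_def)
  have sets [measurable_cong]: "sets M = sets borel" using assms by (simp add: distr_on_def)
  have AE: "AE t in M. t \<in> {0..c}" using assms by (simp add: distr_on_def)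
  show "distr_on M (c + 1)"
    unfolding distr_on_def
    by (intro conjI prob_space_axioms sets eventually_mono[OF AE]) auto
  have "measure M {x..} = 1" if "x \<le> 0" for x
  proof -
    have "AE t in M. t \<in> {x..}" using AE by eventually_elim (use that in auto)
    then show ?thesis by (subst (asm) prob_eq_1[symmetric]) (auto simp: sets)
  qed
  moreover have "measure M {x..} = 0" if "x \<ge> c + 1" for x
  proof -
    have "AE t in M. t \<notin> {x..}" using AE by eventually_elim (use that in auto)
    then show ?thesis by (subst (asm) prob_eq_0[symmetric]) (auto simp: sets)
  qed
  moreover have "antimono (\<lambda>x. measure M {x..})"
    by (intro antimonoI finite_measure_mono) (auto simp: sets)
  ultimately show "termination_function (c + 1) (\<lambda>x. measure M {x..})"
    using assms(2) by (auto simp: termination_function_iff)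
  have "{x..} = {x} \<union> {x<..}" for x :: real by auto
  then have "measure M {x..} = measure M {x} + measure M {x<..}" for x
    using finite_measure_Union[of "{x}" "{x<..}"] by (auto simp: sets)
  then have "{x. measure M {x..} \<noteq> measure M {x<..}} = {x. measure M {x} \<noteq> 0}" by auto
  then show "tail_of M (\<lambda>x. measure M {x..})"
    unfolding tail_of_def using countable_support by simp
qed

section \<open>Convolution preserves limits of averages\<close>

lemma convolution_distr:
  assumes "distr_on M c" "distr_on N d"
  shows "distr_on (M \<star> N) (c + d)"
proof -
  interpret M: prob_space M using assms by (simp add: distr_on_def)
  interpret N: prob_space N using assms by (simp add: distr_on_def)
  interpret pair_prob_space M N ..
  have [measurable_cong]: "sets M = sets borel" "sets N = sets borel"
    using assms by (auto simp: distr_on_def)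
  have "AE x in M. AE y in N. (case (x, y) of (x, y) \<Rightarrow> x + y) \<in> {0..c + d}"
    using assms(1)[unfolded distr_on_def, THEN conjunct2, THEN conjunct2]
  proof eventually_elim
    case (elim x)
    show ?case
      using assms(2)[unfolded distr_on_def, THEN conjunct2, THEN conjunct2]
      by eventually_elim (use elim in auto)
  qed
  then have "AE p in M \<Otimes>\<^sub>M N. (case p of (x, y) \<Rightarrow> x + y) \<in> {0..c + d}"
    by (intro AE_pair_measure) auto
  then have "AE t in M \<star> N. t \<in> {0..c + d}"
    unfolding convolution_def by (subst AE_distr_iff) auto
  moreover have "prob_space (M \<star> N)"
    unfolding convolution_def by (intro P.prob_space_distr) auto
  ultimately show ?thesis by (simp add: distr_on_def)
qed

lemma tendsto_convolution_right:
  fixes F :: "real \<Rightarrow> 'a::euclidean_space"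
  assumes M: "distr_on M c" and N: "distr_on N d" and F: "continuous_on UNIV F"
    and lim: "((\<lambda>b. LINT t|M. F (b + t)) \<longlongrightarrow> L) at_top"
  shows "((\<lambda>b. LINT t|(M \<star> N). F (b + t)) \<longlongrightarrow> L) at_top"
proof -
  interpret M: prob_space M using M by (simp add: distr_on_def)
  interpret N: prob_space N using N by (simp add: distr_on_def)
  interpret pair_prob_space M N ..
  have sets [measurable_cong]: "sets M = sets borel" "sets N = sets borel"
    using M N by (auto simp: distr_on_def)
  have [measurable]: "F \<in> borel_measurable borel"
    using F by (rule borel_measurable_continuous_onI)
  have int: "integrable (M \<Otimes>\<^sub>M N) (\<lambda>(s, t). F (b + (s + t)))" for b
    using integrable_translate[OF convolution_distr[OF M N] F, of b]
    unfolding convolution_def by (simp add: integrable_distr_eq case_prod_beta')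
  have eq: "(LINT t|(M \<star> N). F (b + t)) = (LINT t|N. LINT s|M. F ((b + t) + s))" for b
  proof -
    have "(LINT t|(M \<star> N). F (b + t)) = (LINT p|(M \<Otimes>\<^sub>M N). (case p of (s, t) \<Rightarrow> F (b + (s + t))))"
      unfolding convolution_def by (subst integral_distr) (auto simp: case_prod_beta')
    also have "\<dots> = (LINT t|N. LINT s|M. F (b + (s + t)))"
      using integral_snd[OF int] by simp
    finally show ?thesis by (simp add: algebra_simps)
  qed
  have inner: "integrable N (\<lambda>t. LINT s|M. F ((b + t) + s))" for b
    using integrable_snd[OF int, of b] by (simp add: algebra_simps)
  have AE: "AE t in N. t \<in> {0..d}" using N by (simp add: distr_on_def)
  show ?thesis
  proof (rule tendstoI)
    fix e :: real assume e: "e > 0"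
    then have "\<forall>\<^sub>F b in at_top. dist (LINT s|M. F (b + s)) L < e / 2"
      by (intro tendstoD[OF lim]) simp
    then obtain B where B: "\<And>b. b \<ge> B \<Longrightarrow> dist (LINT s|M. F (b + s)) L < e / 2"
      by (auto simp: eventually_at_top_linorder)
    show "\<forall>\<^sub>F b in at_top. dist (LINT t|(M \<star> N). F (b + t)) L < e"
      using eventually_ge_at_top[of B]
    proof eventually_elim
      case (elim b)
      have "norm ((LINT t|N. LINT s|M. F ((b + t) + s)) - L)
          = norm (LINT t|N. (LINT s|M. F ((b + t) + s)) - L)"
        using inner by (simp add: N.prob_space)
      also have "\<dots> \<le> (LINT t|N. norm ((LINT s|M. F ((b + t) + s)) - L))"
        by (rule integral_norm_bound)
      also have "\<dots> \<le> (LINT t|N. e / 2)"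
      proof (rule integral_mono_AE)
        show "AE t in N. norm ((LINT s|M. F ((b + t) + s)) - L) \<le> e / 2"
          using AE
        proof eventually_elim
          case (elim t)
          then show ?case using B[of "b + t"] \<open>b \<ge> B\<close> by (simp add: dist_norm)
        qed
      qed (auto intro!: integrable_norm inner)
      also have "\<dots> < e" using e by (simp add: N.prob_space)
      finally show ?case unfolding eq dist_norm .
    qed
  qed
qed

lemma tendsto_convolution_left:
  fixes F :: "real \<Rightarrow> 'a::euclidean_space"
  assumes M: "distr_on M c" and N: "distr_on N d" and F: "continuous_on UNIV F"
    and lim: "((\<lambda>b. LINT t|N. F (b + t)) \<longlongrightarrow> L) at_top"
  shows "((\<lambda>b. LINT t|(M \<star> N). F (b + t)) \<longlongrightarrow> L) at_top"
proof -
  have "(M \<star> N) = (N \<star> M)"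
    using M N unfolding distr_on_def
    by (intro convolution_commutative prob_space.finite_measure) auto
  then show ?thesis using tendsto_convolution_right[OF N M F lim] by simp
qed

section \<open>Consistency and linearity of the generalized integral\<close>

lemma has_gen_integral_wrt_unique:
  fixes f :: "real \<Rightarrow> 'a::euclidean_space"
  assumes "termination_function c z" "has_gen_integral_wrt f a c z L"
    and "termination_function d w" "has_gen_integral_wrt f a d w L'"
  shows "L = L'"
proof -
  obtain M where M: "distr_on M c" "tail_of M z" using termination_function_distr assms(1) by blast
  obtain N where N: "distr_on N d" "tail_of N w" using termination_function_distr assms(3) by blast
  have L: "\<forall>b\<ge>a. f integrable_on {a..b}" "((\<lambda>b. LINT t|M. integral {a..b + t} f) \<longlongrightarrow> L) at_top"
    using has_gen_integral_wrt_iff[OF M(1) _ M(2)] termination_function_distr(1) assms(1,2) by blast+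
  have L': "((\<lambda>b. LINT t|N. integral {a..b + t} f) \<longlongrightarrow> L') at_top"
    using has_gen_integral_wrt_iff[OF N(1) _ N(2)] termination_function_distr(1) assms(3,4) by blast
  have F: "continuous_on UNIV (\<lambda>x. integral {a..x} f)"
    using L(1) by (intro continuous_indefinite_integral) blast
  show ?thesis
    using tendsto_convolution_right[OF M(1) N(1) F L(2)]
      tendsto_convolution_left[OF M(1) N(1) F L']
    by (rule tendsto_unique[rotated]) simp
qed

lemma has_gen_integral_iff:
  fixes f :: "real \<Rightarrow> 'a::euclidean_space"
  shows "has_gen_integral f a L \<longleftrightarrow> (\<exists>c z. termination_function c z \<and> has_gen_integral_wrt f a c z L)"
  unfolding has_gen_integral_def using has_gen_integral_wrt_unique by blast

lemma has_gen_integral_linear: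
  fixes f g :: "real \<Rightarrow> 'a::{real_normed_field, euclidean_space}"
  assumes "has_gen_integral f a A" "has_gen_integral g a B"
  shows "has_gen_integral (\<lambda>x. \<alpha> * f x + \<beta> * g x) a (\<alpha> * A + \<beta> * B)"
proof -
  obtain c z where z: "termination_function c z" "has_gen_integral_wrt f a c z A"
    using assms(1) by (auto simp: has_gen_integral_def)
  obtain d w where w: "termination_function d w" "has_gen_integral_wrt g a d w B"
    using assms(2) by (auto simp: has_gen_integral_def)
  have c: "c > 0" and d: "d > 0" using z w termination_function_distr(1) by blast+
  obtain M where M: "distr_on M c" "tail_of M z" using termination_function_distr z(1) by blast
  obtain N where N: "distr_on N d" "tail_of N w" using termination_function_distr w(1) by blast
  have f: "\<forall>b\<ge>a. f integrable_on {a..b}" "((\<lambda>b. LINT t|M. integral {a..b + t} f) \<longlongrightarrow> A) at_top"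
    using has_gen_integral_wrt_iff[OF M(1) c M(2)] z(2) by blast+
  have g: "\<forall>b\<ge>a. g integrable_on {a..b}" "((\<lambda>b. LINT t|N. integral {a..b + t} g) \<longlongrightarrow> B) at_top"
    using has_gen_integral_wrt_iff[OF N(1) d N(2)] w(2) by blast+
  have F: "continuous_on UNIV (\<lambda>x. integral {a..x} f)"
    using f(1) by (intro continuous_indefinite_integral) blast
  have G: "continuous_on UNIV (\<lambda>x. integral {a..x} g)"
    using g(1) by (intro continuous_indefinite_integral) blast
  define Q where "Q = (M \<star> N)"
  have Q: "distr_on Q (c + d)" unfolding Q_def using M(1) N(1) by (rule convolution_distr)
  have limf: "((\<lambda>b. LINT t|Q. integral {a..b + t} f) \<longlongrightarrow> A) at_top"
    unfolding Q_def by (rule tendsto_convolution_right[OF M(1) N(1) F f(2)])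
  have limg: "((\<lambda>b. LINT t|Q. integral {a..b + t} g) \<longlongrightarrow> B) at_top"
    unfolding Q_def by (rule tendsto_convolution_left[OF M(1) N(1) G g(2)])
  define h where "h = (\<lambda>x. \<alpha> * f x + \<beta> * g x)"
  have h: "(h has_integral \<alpha> * integral {a..x} f + \<beta> * integral {a..x} g) {a..x}" for x
  proof (cases "x \<ge> a")
    case True
    then show ?thesis
      unfolding h_def using f(1) g(1)
      by (intro has_integral_add has_integral_mult_right integrable_integral) auto
  qed simp
  have "(LINT t|Q. integral {a..b + t} h)
      = \<alpha> * (LINT t|Q. integral {a..b + t} f) + \<beta> * (LINT t|Q. integral {a..b + t} g)" for b
    using integrable_translate[OF Q F, of b] integrable_translate[OF Q G, of b]
    by (simp add: integral_unique[OF h])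
  then have "((\<lambda>b. LINT t|Q. integral {a..b + t} h) \<longlongrightarrow> \<alpha> * A + \<beta> * B) at_top"
    using limf limg by (auto intro!: tendsto_intros)
  moreover have "\<forall>b\<ge>a. h integrable_on {a..b}" using h by (auto simp: has_integral_integrable)
  moreover note tf = distr_termination_function[OF Q]
  ultimately have "has_gen_integral_wrt h a (c + d + 1) (\<lambda>x. measure Q {x..}) (\<alpha> * A + \<beta> * B)"
    using c d by (subst has_gen_integral_wrt_iff[of Q]) auto
  then show ?thesis
    unfolding has_gen_integral_iff h_def[symmetric] using tf(1) c d by (meson add_pos_pos)
qed

theorem theorem3:
  fixes f g :: "real \<Rightarrow> 'a::{real_normed_field, euclidean_space}"
    and a :: real and \<alpha> \<beta> :: 'a
  assumes "gen_integrable f a" and "gen_integrable g a"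
  shows "gen_integrable (\<lambda>x. \<alpha> * f x + \<beta> * g x) a \<and>
    \<alpha> * gen_integral f a + \<beta> * gen_integral g a = gen_integral (\<lambda>x. \<alpha> * f x + \<beta> * g x) a"
proof -
  obtain A B where A: "has_gen_integral f a A" and B: "has_gen_integral g a B"
    using assms by (auto simp: gen_integrable_def)
  have "has_gen_integral (\<lambda>x. \<alpha> * f x + \<beta> * g x) a (\<alpha> * A + \<beta> * B)"
    using A B by (rule has_gen_integral_linear)
  then show ?thesis
    using A B by (auto simp: gen_integrable_def gen_integral_eqI)
qed

end
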